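(* Let $\phi$ be a model function with constant $C=C(\phi)>0$ (so $\phi(x)\le Cx$ for all $x\ge 0$), let $E\subset\mathbb{T}$ be a closed set and let $K>0$. Let $B$ be a Blaschke product with zero sequence $Z(B)=\{z_n\}_{n\ge1}$ such that $Z(B)\subset\mathcal{S}_\phi(E,K)$. Then for all $z\in\mathbb{D}$ $$|B'(z)|\le 2(2C+K)^2\sum_{n=1}^\infty(1-|z_n|)\,\phi^{-2}\left(\frac{d(z,E)}6\right),$$ where $\phi^{-2}(x)=1/\phi(x)^2$.
   Context: $\mathbb{D}$ is the open unit disk in $\mathbb{C}$, $\mathbb{T}$ the unit circle, and $d(z,E)=\mathrm{dist}(z,E)$ is the Euclidean distance from $z$ to $E$. Blaschke product: for a sequence $\{z_n\}_{n\ge1}\subset\mathbb{D}$ (repetitions allowed) with $\sum_{n=1}^\infty(1-|z_n|)<\infty$, $$B(z)=\prod_{n=1}^\infty b_n(z),\qquad b_n(z)=\frac{\overline{z_n}}{|z_n|}\,\frac{z_n-z}{1-\overline{z_n}z},$$ and $Z(B)=\{z_n\}$ is its zero set, zeros being listed with multiplicity. Standing assumption: $B(0)\neq0$, i.e. all $z_n\ne0$. Model function: a function $\phi$ on $[0,\infty)$ that is nonnegative, continuous and increasing, and satisfies $\phi(x)\le Cx$ for all $x\ge0$ with some constant $C=C(\phi)>0$. Stolz angle associated with $\phi$ with vertex $t\in\mathbb{T}$: for $K>0$, $\mathcal{S}_\phi(t,K)=\{\lambda\in\mathbb{D}:\ \phi(|t-\lambda|)\le K(1-|\lambda|)\}$.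 Stolz region associated with $\phi$ and a closed set $E\subset\mathbb{T}$: $\mathcal{S}_\phi(E,K)=\{\lambda\in\mathbb{D}:\ \phi(d(\lambda,E))\le K(1-|\lambda|)\}=\bigcup_{t\in E}\mathcal{S}_\phi(t,K)$. *)

theory Defs
  imports "HOL-Complex_Analysis.Complex_Analysis"
begin

definition blaschke_sequence :: "(nat \<Rightarrow> complex) \<Rightarrow> bool" where
  "blaschke_sequence a \<longleftrightarrow>
     (\<forall>n. a n \<in> ball 0 1 \<and> a n \<noteq> 0) \<and> summable (\<lambda>n. 1 - norm (a n))"

definition blaschke_factor :: "complex \<Rightarrow> complex \<Rightarrow> complex" where
  "blaschke_factor a z = (cnj a / of_real (norm a)) * ((a - z) / (1 - cnj a * z))"

definition blaschke_product :: "(nat \<Rightarrow> complex) \<Rightarrow> complex \<Rightarrow> complex" where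
  "blaschke_product a z = (\<Prod>n. blaschke_factor (a n) z)"

text \<open>Only the values of \<open>\<phi>\<close> on the nonnegative reals matter.
  ``Increasing'' is read in the weak sense, so \<open>\<phi>\<close> may vanish at positive arguments;
  bounds involving \<open>1 / \<phi>(x)\<^sup>2\<close> are therefore to be stated in \<^typ>\<open>ennreal\<close>, where
  \<open>c / 0 = \<infinity>\<close> for \<open>c > 0\<close>.\<close>

definition model_function :: "(real \<Rightarrow> real) \<Rightarrow> real \<Rightarrow> bool" where
  "model_function \<phi> C \<longleftrightarrow>
     0 < C \<and> continuous_on {0..} \<phi> \<and> mono_on {0..} \<phi> \<and>
     (\<forall>x\<ge>0. 0 \<le> \<phi> x \<and> \<phi> x \<le> C * x)"

definition stolz_angle :: "(real \<Rightarrow> real) \<Rightarrow> complex \<Rightarrow> real \<Rightarrow> complex set" where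
  "stolz_angle \<phi> t K = {w \<in> ball 0 1. \<phi> (norm (t - w)) \<le> K * (1 - norm w)}"

definition stolz_region :: "(real \<Rightarrow> real) \<Rightarrow> complex set \<Rightarrow> real \<Rightarrow> complex set" where
  "stolz_region \<phi> E K = {w \<in> ball 0 1. \<phi> (infdist w E) \<le> K * (1 - norm w)}"

text \<open>Nonemptiness is needed because \<open>infdist w {} = 0\<close>.\<close>

lemma stolz_region_eq_UN_stolz_angle:
  assumes "model_function \<phi> C" and "closed E" and "E \<noteq> {}"
  shows "stolz_region \<phi> E K = (\<Union>t\<in>E. stolz_angle \<phi> t K)"
proof (intro equalityI subsetI)
  fix w assume w: "w \<in> stolz_region \<phi> E K"
  obtain t where "t \<in> E" "infdist w E = dist w t"
    using infdist_attains_inf[OF assms(2,3)] by blast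
  with w show "w \<in> (\<Union>t\<in>E. stolz_angle \<phi> t K)"
    by (auto simp: stolz_region_def stolz_angle_def dist_norm norm_minus_commute)
next
  fix w assume "w \<in> (\<Union>t\<in>E. stolz_angle \<phi> t K)"
  then obtain t where t: "t \<in> E" "w \<in> stolz_angle \<phi> t K" by blast
  have "infdist w E \<le> norm (t - w)"
    using infdist_le[OF t(1), of w] by (simp add: dist_norm norm_minus_commute)
  then have "\<phi> (infdist w E) \<le> \<phi> (norm (t - w))"
    using assms(1) infdist_nonneg[of w E] by (auto simp: model_function_def mono_on_def)
  with t show "w \<in> stolz_region \<phi> E K"
    by (auto simp: stolz_region_def stolz_angle_def)
qed

end

theory Submission
  imports Defs
begin

text \<open>
  The derivative of a single Blaschke factor has modulus
  \<open>(1 - |a|\<^sup>2) / |1 - cnj a * z|\<^sup>2\<close>, and every factor is bounded by \<open>1\<close> on the disk. By the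
  product rule, each partial product therefore has a derivative bounded by the sum of these
  quantities, and locally uniform convergence carries the bound over to \<open>B'\<close>
  (\<open>norm_deriv_blaschke_product_le\<close>).

  It remains to bound \<open>|1 - cnj a * z|\<close> from below when the zero \<open>a\<close> lies in the Stolz region
  (\<open>stolz_region_separation\<close>). This quantity dominates both \<open>1 - |a|\<close> and the distance
  \<open>|a - z|\<close>. If \<open>a\<close> is at least \<open>d(z,E)/6\<close> away from \<open>E\<close>, the Stolz condition together with the
  monotonicity of \<open>\<phi>\<close> makes \<open>1 - |a|\<close> large enough. If \<open>a\<close> is closer to \<open>E\<close>, the triangle
  inequality keeps it away from \<open>z\<close>, and the linear bound on \<open>\<phi>\<close> finishes.
\<close>

section \<open>A single Blaschke factor\<close>

lemma norm_one_minus_cnj_mult_sq: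
  "(norm (1 - cnj a * z))\<^sup>2 = (norm (a - z))\<^sup>2 + (1 - (norm a)\<^sup>2) * (1 - (norm z)\<^sup>2)"
  by (simp add: cmod_power2) (simp add: power2_eq_square algebra_simps)

text \<open>This is the bound \<open>1\<close> on the pseudo-hyperbolic distance. It also lets the Euclidean distance
  \<open>|a - z|\<close>, to which the triangle inequality applies, stand in for \<open>|1 - cnj a * z|\<close>.\<close>

lemma norm_diff_le_norm_one_minus_cnj_mult:
  assumes "norm a \<le> 1" "norm z \<le> 1"
  shows "norm (a - z) \<le> norm (1 - cnj a * z)"
proof (rule power2_le_imp_le)
  have "0 \<le> (1 - (norm a)\<^sup>2) * (1 - (norm z)\<^sup>2)"
    using assms by (intro mult_nonneg_nonneg) (auto simp: power_le_one)
  then show "(norm (a - z))\<^sup>2 \<le> (norm (1 - cnj a * z))\<^sup>2"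
    by (simp add: norm_one_minus_cnj_mult_sq)
qed simp

lemma one_minus_mult_le_norm_one_minus_cnj_mult:
  "1 - norm a * norm z \<le> norm (1 - cnj a * z)"
  using norm_triangle_ineq2[of 1 "cnj a * z"] by (simp add: norm_mult)

lemma one_minus_norm_le_norm_one_minus_cnj_mult:
  assumes "norm z \<le> 1"
  shows "1 - norm a \<le> norm (1 - cnj a * z)"
  using one_minus_mult_le_norm_one_minus_cnj_mult[of a z] mult_left_mono[OF assms, of "norm a"]
  by simp

lemma one_minus_cnj_mult_nonzero:
  assumes "norm a < 1" "norm z \<le> 1"
  shows "1 - cnj a * z \<noteq> 0"
  using one_minus_norm_le_norm_one_minus_cnj_mult[of z a] assms by auto

lemma norm_blaschke_factor_le_1:
  assumes "norm a < 1" "norm z \<le> 1"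
  shows "norm (blaschke_factor a z) \<le> 1"
proof -
  have "norm (a - z) / norm (1 - cnj a * z) \<le> 1"
    using norm_diff_le_norm_one_minus_cnj_mult[of a z] assms by (simp add: divide_le_eq_1)
  then show ?thesis
    by (simp add: blaschke_factor_def norm_mult norm_divide)
qed

lemma has_field_derivative_blaschke_factor:
  assumes "norm a < 1" "norm z \<le> 1"
  shows "(blaschke_factor a has_field_derivative
           (cnj a / of_real (norm a)) * (((norm a)\<^sup>2 - 1) / (1 - cnj a * z)\<^sup>2)) (at z)"
proof -
  have "(-1) * (1 - cnj a * z) - (a - z) * (- cnj a) = complex_of_real ((norm a)\<^sup>2 - 1)"
    by (simp add: complex_norm_square[unfolded of_real_power] algebra_simps)
  moreover have "((\<lambda>z. (a - z) / (1 - cnj a * z)) has_field_derivative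
      ((-1) * (1 - cnj a * z) - (a - z) * (- cnj a)) / ((1 - cnj a * z) * (1 - cnj a * z))) (at z)"
    using one_minus_cnj_mult_nonzero[OF assms]
    by (auto intro!: derivative_eq_intros)
  ultimately have "((\<lambda>z. (a - z) / (1 - cnj a * z)) has_field_derivative
      ((norm a)\<^sup>2 - 1) / (1 - cnj a * z)\<^sup>2) (at z)"
    by (simp only: of_real_diff of_real_1 of_real_power power2_eq_square of_real_mult)
  then show ?thesis
    unfolding blaschke_factor_def[abs_def] by (rule DERIV_cmult)
qed

lemma norm_derivative_blaschke_factor:
  assumes "norm a < 1" "a \<noteq> 0"
  shows "norm ((cnj a / of_real (norm a)) * (((norm a)\<^sup>2 - 1) / (1 - cnj a * z)\<^sup>2))
       = (1 - (norm a)\<^sup>2) / (norm (1 - cnj a * z))\<^sup>2"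
proof -
  have "norm (((norm a)\<^sup>2 - 1) :: complex) = 1 - (norm a)\<^sup>2"
  proof -
    have "norm (complex_of_real ((norm a)\<^sup>2 - 1)) = 1 - (norm a)\<^sup>2"
      unfolding norm_of_real using assms(1) by (simp add: abs_minus_commute[of _ 1] power_le_one)
    then show ?thesis by simp
  qed
  then show ?thesis
    using assms(2) by (simp add: norm_mult norm_divide norm_power)
qed

text \<open>The unimodular constant \<open>cnj a / |a|\<close> is what makes \<open>1 - blaschke_factor a z\<close> divisible by
  \<open>1 - |a|\<close>, so that the Blaschke condition gives absolute convergence of the product.\<close>

lemma norm_blaschke_factor_minus_1_le:
  assumes "norm a < 1" "a \<noteq> 0" "norm z \<le> r" "r < 1"
  shows "norm (blaschke_factor a z - 1) \<le> 2 / (1 - r) * (1 - norm a)"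
proof -
  have nz: "1 - cnj a * z \<noteq> 0"
    using one_minus_cnj_mult_nonzero[of a z] assms by auto
  have sq: "cnj a * a = of_real (norm a) * of_real (norm a)"
    by (metis complex_norm_square mult.commute power2_eq_square of_real_mult)
  have eq: "blaschke_factor a z - 1
      = - (of_real (1 - norm a) * ((of_real (norm a) + cnj a * z) / (of_real (norm a) * (1 - cnj a * z))))"
    using nz assms(2) sq unfolding blaschke_factor_def
    by (simp add: field_simps)
  have num: "norm (of_real (norm a) + cnj a * z) \<le> norm a * 2"
  proof -
    have "norm (of_real (norm a) + cnj a * z) \<le> norm a + norm a * norm z"
      using norm_triangle_ineq[of "of_real (norm a)" "cnj a * z"] by (simp add: norm_mult)
    also have "\<dots> \<le> norm a * 2"
      using assms(3,4) mult_left_mono[of "norm z" 1 "norm a"] by simp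
    finally show ?thesis .
  qed
  have den: "1 - r \<le> norm (1 - cnj a * z)"
  proof -
    have "norm a * norm z \<le> 1 * r"
      using assms by (intro mult_mono) auto
    then show ?thesis
      using one_minus_mult_le_norm_one_minus_cnj_mult[of a z] by simp
  qed
  have "norm (blaschke_factor a z - 1)
      = (1 - norm a) * (norm (of_real (norm a) + cnj a * z) / (norm a * norm (1 - cnj a * z)))"
    unfolding eq using assms(1) by (simp add: norm_mult norm_divide del: of_real_diff)
  also have "\<dots> \<le> (1 - norm a) * (norm a * 2 / (norm a * (1 - r)))"
    using assms num den
    by (intro mult_left_mono frac_le mult_pos_pos) auto
  also have "\<dots> = 2 / (1 - r) * (1 - norm a)"
    using assms(2) by simp
  finally show ?thesis .
qed

section \<open>The derivative of a Blaschke product\<close>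

lemma uniform_limit_blaschke_product:
  assumes a: "blaschke_sequence a" and r: "r < 1"
  shows "uniform_limit (cball 0 r) (\<lambda>N z. \<Prod>n<N. blaschke_factor (a n) z)
           (blaschke_product a) sequentially"
proof -
  have an: "norm (a n) < 1" "a n \<noteq> 0" for n
    using a by (auto simp: blaschke_sequence_def)
  have sm: "summable (\<lambda>n. 1 - norm (a n))"
    using a by (simp add: blaschke_sequence_def)
  have sm': "summable (\<lambda>n. 2 / (1 - r) * (1 - norm (a n)))"
    using sm by (rule summable_mult)
  have bound: "norm (blaschke_factor (a n) z - 1) \<le> 2 / (1 - r) * (1 - norm (a n))"
    if "z \<in> cball 0 r" for n z
    using that norm_blaschke_factor_minus_1_le[OF an, of z r] r by auto
  have "uniform_limit (cball 0 r) (\<lambda>N z. \<Sum>n<N. norm (blaschke_factor (a n) z - 1))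
          (\<lambda>z. \<Sum>n. norm (blaschke_factor (a n) z - 1)) sequentially"
    using bound by (intro Weierstrass_m_test[OF _ sm']) simp
  then have "uniformly_convergent_on (cball 0 r)
      (\<lambda>N z. \<Sum>n<N. norm (blaschke_factor (a n) z - 1))"
    by (rule uniformly_convergentI)
  moreover have "continuous_on (cball 0 r) (blaschke_factor (a n))" for n
  proof (intro continuous_at_imp_continuous_on ballI)
    fix w :: complex assume "w \<in> cball 0 r"
    then have "norm w \<le> 1" using r by simp
    then show "isCont (blaschke_factor (a n)) w"
      by (rule DERIV_isCont[OF has_field_derivative_blaschke_factor[OF an(1)]])
  qed
  ultimately have "uniformly_convergent_on (cball 0 r)
      (\<lambda>N z. \<Prod>n<N. blaschke_factor (a n) z)"
    by (intro uniformly_convergent_on_prod') auto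
  then obtain g where g: "uniform_limit (cball 0 r)
      (\<lambda>N z. \<Prod>n<N. blaschke_factor (a n) z) g sequentially"
    by (auto simp: uniformly_convergent_on_def)
  have "g z = blaschke_product a z" if z: "z \<in> cball 0 r" for z
  proof -
    have "summable (\<lambda>n. norm (blaschke_factor (a n) z - 1))"
      using bound[OF z] by (intro summable_comparison_test'[OF sm']) auto
    then have "convergent_prod (\<lambda>n. blaschke_factor (a n) z)"
      by (intro abs_convergent_prod_imp_convergent_prod summable_imp_abs_convergent_prod)
    then have "(\<lambda>N. \<Prod>n\<le>N. blaschke_factor (a n) z) \<longlonglongrightarrow> blaschke_product a z"
      unfolding blaschke_product_def by (rule convergent_prod_LIMSEQ)
    then have "(\<lambda>N. \<Prod>n<N. blaschke_factor (a n) z) \<longlonglongrightarrow> blaschke_product a z"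
      by (subst (asm) lessThan_Suc_atMost[symmetric]) (rule LIMSEQ_imp_Suc)
    with tendsto_uniform_limitI[OF g z] show ?thesis
      by (rule LIMSEQ_unique)
  qed
  with g show ?thesis
    by (subst (asm) uniform_limit_cong') auto
qed

text \<open>The product rule expresses the derivative as a sum in which all undifferentiated factors
  are contractions.\<close>

lemma norm_deriv_prod_le:
  fixes f :: "'i \<Rightarrow> 'a::real_normed_field \<Rightarrow> 'a"
  assumes "\<And>i. i \<in> A \<Longrightarrow> (f i has_field_derivative f' i) (at z)"
    and "\<And>i. i \<in> A \<Longrightarrow> norm (f i z) \<le> 1"
  shows "norm (deriv (\<lambda>w. \<Prod>i\<in>A. f i w) z) \<le> (\<Sum>i\<in>A. norm (f' i))"
proof -
  have "deriv (\<lambda>w. \<Prod>i\<in>A. f i w) z = (\<Sum>i\<in>A. f' i * (\<Prod>j\<in>A - {i}. f j z))"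
    using assms(1) by (intro DERIV_imp_deriv has_field_derivative_prod) auto
  also have "norm \<dots> \<le> (\<Sum>i\<in>A. norm (f' i * (\<Prod>j\<in>A - {i}. f j z)))"
    by (rule norm_sum)
  also have "\<dots> \<le> (\<Sum>i\<in>A. norm (f' i))"
  proof (rule sum_mono)
    fix i
    have "(\<Prod>j\<in>A - {i}. norm (f j z)) \<le> 1"
      using assms(2) by (intro prod_le_1) auto
    then show "norm (f' i * (\<Prod>j\<in>A - {i}. f j z)) \<le> norm (f' i)"
      by (simp add: norm_mult prod_norm[symmetric] mult_left_le)
  qed
  finally show ?thesis .
qed

text \<open>Locally uniform convergence of holomorphic functions entails convergence of their derivatives,
  so a bound shared by the derivatives of all partial products survives the limit.\<close>

lemma norm_deriv_blaschke_product_le: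
  assumes a: "blaschke_sequence a" and z: "norm z < 1"
    and le: "\<And>n. (1 - (norm (a n))\<^sup>2) / (norm (1 - cnj (a n) * z))\<^sup>2 \<le> M n"
    and M: "summable M"
  shows "norm (deriv (blaschke_product a) z) \<le> (\<Sum>n. M n)"
proof -
  have an: "norm (a n) < 1" "a n \<noteq> 0" for n
    using a by (auto simp: blaschke_sequence_def)
  obtain r where r: "norm z < r" "r < 1"
    using dense[OF z] by blast
  define P where "P N w = (\<Prod>n<N. blaschke_factor (a n) w)" for N w
  have "uniform_limit (ball 0 r) P (blaschke_product a) sequentially"
    unfolding P_def
    by (rule uniform_limit_on_subset[OF uniform_limit_blaschke_product[OF a r(2)]]) auto
  moreover have "blaschke_factor (a n) holomorphic_on ball 0 r" for n
  proof -
    have "\<exists>f'. (blaschke_factor (a n) has_field_derivative f') (at w)" if "w \<in> ball 0 r" for w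
      using has_field_derivative_blaschke_factor[OF an(1), of w n] that r(2) by auto
    then show ?thesis
      by (simp add: holomorphic_on_open)
  qed
  then have "P N holomorphic_on ball 0 r" for N
    unfolding P_def by (intro holomorphic_on_prod)
  ultimately have "(\<lambda>N. (deriv ^^ 1) (P N) z) \<longlonglongrightarrow> (deriv ^^ 1) (blaschke_product a) z"
    using r by (intro higher_deriv_complex_uniform_limit[where A = "ball 0 r"]) auto
  then have lim: "(\<lambda>N. norm (deriv (P N) z)) \<longlonglongrightarrow> norm (deriv (blaschke_product a) z)"
    by (intro tendsto_norm) simp
  have M0: "0 \<le> M n" for n
  proof -
    have "0 \<le> (1 - (norm (a n))\<^sup>2) / (norm (1 - cnj (a n) * z))\<^sup>2"
      using an(1)[of n] by (simp add: power_le_one)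
    with le[of n] show ?thesis by linarith
  qed
  have "norm (deriv (P N) z) \<le> (\<Sum>n. M n)" for N
  proof -
    have "norm (deriv (P N) z)
        \<le> (\<Sum>n<N. norm ((cnj (a n) / of_real (norm (a n))) *
              (((norm (a n))\<^sup>2 - 1) / (1 - cnj (a n) * z)\<^sup>2)))"
      unfolding P_def using z an(1)
      by (intro norm_deriv_prod_le has_field_derivative_blaschke_factor
            norm_blaschke_factor_le_1) auto
    also have "\<dots> \<le> (\<Sum>n<N. M n)"
      using le by (intro sum_mono) (simp only: norm_derivative_blaschke_factor[OF an])
    also have "\<dots> \<le> (\<Sum>n. M n)"
      using M0 M by (intro sum_le_suminf) auto
    finally show ?thesis .
  qed
  then show ?thesis
    by (intro LIMSEQ_le_const2[OF lim]) auto
qed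

section \<open>Separation from a Stolz region\<close>

text \<open>A zero \<open>w\<close> can make \<open>|1 - cnj w * z|\<close> small only if it is close to \<open>z\<close>, hence far from \<open>E\<close>
  relative to \<open>d(z,E)\<close>; but then the Stolz condition keeps \<open>w\<close> away from the unit circle. The two
  alternatives contribute the summands \<open>C\<close> and \<open>K\<close> of the constant.\<close>

lemma stolz_region_separation:
  assumes \<phi>: "model_function \<phi> C" and K: "0 < K"
    and w: "w \<in> stolz_region \<phi> E K" and z: "norm z \<le> 1"
  shows "\<phi> (infdist z E / 6) \<le> (2 * C + K) * norm (1 - cnj w * z)"
proof -
  have C: "0 < C" and mono: "mono_on {0..} \<phi>" and lin: "\<And>x. 0 \<le> x \<Longrightarrow> \<phi> x \<le> C * x"
    using \<phi> by (auto simp: model_function_def)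
  have w1: "norm w < 1" and wS: "\<phi> (infdist w E) \<le> K * (1 - norm w)"
    using w by (auto simp: stolz_region_def)
  let ?\<delta> = "norm (1 - cnj w * z)"
  show ?thesis
  proof (cases "infdist z E / 6 \<le> infdist w E")
    case True
    then have "\<phi> (infdist z E / 6) \<le> \<phi> (infdist w E)"
      using mono infdist_nonneg[of z E] by (auto simp: mono_on_def)
    also have "\<dots> \<le> K * ?\<delta>"
      using wS K one_minus_norm_le_norm_one_minus_cnj_mult[OF z, of w]
      by (meson mult_left_mono order_trans less_imp_le)
    also have "\<dots> \<le> (2 * C + K) * ?\<delta>"
      using C by (intro mult_right_mono) auto
    finally show ?thesis .
  next
    case False
    have "infdist z E \<le> infdist w E + norm (w - z)"
      using infdist_triangle[of z E w] by (simp add: dist_norm norm_minus_commute)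
    then have "infdist z E / 6 \<le> ?\<delta>"
      using False norm_diff_le_norm_one_minus_cnj_mult[of w z] w1 z infdist_nonneg[of z E]
      by linarith
    then have "C * (infdist z E / 6) \<le> C * ?\<delta>"
      using C by (intro mult_left_mono) auto
    then have "\<phi> (infdist z E / 6) \<le> C * ?\<delta>"
      using lin[of "infdist z E / 6"] infdist_nonneg[of z E] by linarith
    also have "\<dots> \<le> (2 * C + K) * ?\<delta>"
      using C K by (intro mult_right_mono) auto
    finally show ?thesis .
  qed
qed

theorem theorem1:
  fixes \<phi> :: "real \<Rightarrow> real" and C K :: real
    and E :: "complex set" and a :: "nat \<Rightarrow> complex" and z :: complex
  assumes "model_function \<phi> C"
    and "closed E" and "E \<subseteq> sphere 0 1"
    and "0 < K"
    and "blaschke_sequence a"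
    and "range a \<subseteq> stolz_region \<phi> E K"
    and "z \<in> ball 0 1"
  shows "ennreal (norm (deriv (blaschke_product a) z))
    \<le> ennreal (2 * (2 * C + K)\<^sup>2 * (\<Sum>n. 1 - norm (a n))) / (ennreal (\<phi> (infdist z E / 6)))\<^sup>2"
proof -
  define p where "p = \<phi> (infdist z E / 6)"
  define L where "L = 2 * C + K"
  have C: "0 < C" and p0: "0 \<le> p"
    using assms(1) infdist_nonneg[of z E] by (auto simp: model_function_def p_def)
  then have L: "0 < L" using assms(4) by (simp add: L_def)
  have z: "norm z < 1" using assms(7) by simp
  have an: "norm (a n) < 1" for n
    using assms(5) by (auto simp: blaschke_sequence_def)
  have sm: "summable (\<lambda>n. 1 - norm (a n))"
    using assms(5) by (simp add: blaschke_sequence_def)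
  have S: "0 < (\<Sum>n. 1 - norm (a n))"
    using an by (intro suminf_pos sm) auto
  show ?thesis
  proof (cases "p = 0")
    \<comment> \<open>A vanishing \<open>\<phi>\<close> makes the right-hand side infinite, because the numerator is positive.\<close>
    case True
    then show ?thesis
      using S L by (simp add: p_def[symmetric] L_def[symmetric])
  next
    case False
    with p0 have p: "0 < p" by simp
    have le: "(1 - (norm (a n))\<^sup>2) / (norm (1 - cnj (a n) * z))\<^sup>2
        \<le> 2 * L\<^sup>2 / p\<^sup>2 * (1 - norm (a n))" for n
    proof -
      let ?\<delta> = "norm (1 - cnj (a n) * z)"
      have "p \<le> L * ?\<delta>"
        unfolding p_def L_def using assms(1,4,6) z by (intro stolz_region_separation) auto
      then have "p / L \<le> ?\<delta>"
        using L by (simp add: divide_le_eq mult.commute)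
      then have "(p / L)\<^sup>2 \<le> ?\<delta>\<^sup>2"
        using p L by (intro power_mono) auto
      moreover have "1 - (norm (a n))\<^sup>2 \<le> 2 * (1 - norm (a n))"
        using zero_le_power2[of "1 - norm (a n)"] by (simp add: power2_eq_square algebra_simps)
      ultimately have "(1 - (norm (a n))\<^sup>2) / ?\<delta>\<^sup>2 \<le> 2 * (1 - norm (a n)) / (p / L)\<^sup>2"
        using p L an[of n] by (intro frac_le) auto
      also have "2 * (1 - norm (a n)) / (p / L)\<^sup>2 = 2 * L\<^sup>2 / p\<^sup>2 * (1 - norm (a n))"
        by (simp add: power_divide)
      finally show ?thesis .
    qed
    have "norm (deriv (blaschke_product a) z) \<le> (\<Sum>n. 2 * L\<^sup>2 / p\<^sup>2 * (1 - norm (a n)))"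
      by (rule norm_deriv_blaschke_product_le[OF assms(5) z le summable_mult[OF sm]])
    also have "\<dots> = 2 * L\<^sup>2 * (\<Sum>n. 1 - norm (a n)) / p\<^sup>2"
      using suminf_mult[OF sm, of "2 * L\<^sup>2 / p\<^sup>2"] by simp
    finally have "ennreal (norm (deriv (blaschke_product a) z))
        \<le> ennreal (2 * L\<^sup>2 * (\<Sum>n. 1 - norm (a n)) / p\<^sup>2)"
      by (rule ennreal_leI)
    also have "\<dots> = ennreal (2 * L\<^sup>2 * (\<Sum>n. 1 - norm (a n))) / (ennreal p)\<^sup>2"
      using S p by (simp add: divide_ennreal ennreal_power)
    finally show ?thesis
      by (simp add: p_def L_def)
  qed
qed

end
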